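(* Let $G$ be a finite group with $C_4$-free power graph $\mathcal{P}(G)$, such that $G$ is not a group of prime power order. Let $p$ be a prime. If the center $Z(G)$ is an elementary abelian $p$-group of order greater than $p$, then for every prime $q\neq p$ and every non-trivial $q$-element $x\in G$ we have $\pi(C_G(x))=\{p,q\}$, and if moreover $|x|>q$, then (1) $\exp(S_p(C_G(x)))=p$ and $S_q(C_G(x))$ is a normal cyclic subgroup of $C_G(x)$; (2) $C_G(x)=S_p(C_G(x))\times S_q(C_G(x))$ or $C_G(x)=(S_p(C_{C_G(x)}(y))\times S_q(C_G(x)))\rtimes\mathbb{Z}_p$, where $\langle y\rangle=S_q(C_G(x))$.
   Context: The power graph $\mathcal{P}(G)$ of a finite group $G$ is the simple graph with vertex set $G$ in which two distinct elements $x,y$ are adjacent if and only if $x\in\langle y\rangle$ or $y\in\langle x\rangle$. A graph is $C_4$-free if it has no induced subgraph isomorphic to the cycle $C_4$ of length four. $S_p(G)$ denotes a Sylow $p$-subgroup of $G$, $\exp(G)$ the exponent of $G$, $\pi(G)$ the set of prime divisors of $|G|$, $C_G(x)$ the centralizer of $x$ in $G$, and $|x|$ the order of $x$. $N\rtimes H$ denotes a semidirect product with normal factor $N$. *)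

theory Defs
  imports
    "HOL-Algebra.Elementary_Groups"
    "HOL-Algebra.Multiplicative_Group"
    "HOL-Number_Theory.Prime_Powers"
    "Graph_Theory.Pair_Digraph"
    "Graph_Theory.Digraph_Component"
    "Graph_Theory.Digraph_Isomorphism"
begin

text \<open>A simple graph is encoded as an irreflexive pair digraph with a symmetric arc relation.\<close>

definition power_graph :: "('a, 'b) monoid_scheme \<Rightarrow> 'a pair_pre_digraph" where
  "power_graph G =
    \<lparr>pverts = carrier G,
     parcs = {(x, y). x \<in> carrier G \<and> y \<in> carrier G \<and> x \<noteq> y \<and>
                      (x \<in> generate G {y} \<or> y \<in> generate G {x})}\<rparr>"

text \<open>Intended for \<open>n \<ge> 3\<close> only; for \<open>n = 1\<close> it has a loop.\<close>

definition cycle_graph :: "nat \<Rightarrow> nat pair_pre_digraph" where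
  "cycle_graph n =
    \<lparr>pverts = {..<n},
     parcs = {(i, j). i < n \<and> j < n \<and> (j = (i + 1) mod n \<or> i = (j + 1) mod n)}\<rparr>"

definition C4_free :: "('a, 'b) pre_digraph \<Rightarrow> bool" where
  "C4_free \<Gamma> \<longleftrightarrow>
    \<not> (\<exists>\<Delta>. induced_subgraph \<Delta> \<Gamma> \<and> digraph_iso (with_proj (cycle_graph 4)) \<Delta>)"

text \<open>Subgroups that are again used as ambient groups (centre, centralizers) are returned as
  group records, like \<^const>\<open>subgroup_generated\<close>; all other subgroups are carrier sets.\<close>

definition center :: "('a, 'b) monoid_scheme \<Rightarrow> ('a, 'b) monoid_scheme" where
  "center G =
    G\<lparr>carrier := {z \<in> carrier G. \<forall>g \<in> carrier G. z \<otimes>\<^bsub>G\<^esub> g = g \<otimes>\<^bsub>G\<^esub> z}\<rparr>"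

definition centralizer :: "('a, 'b) monoid_scheme \<Rightarrow> 'a \<Rightarrow> ('a, 'b) monoid_scheme" where
  "centralizer G x = G\<lparr>carrier := {g \<in> carrier G. g \<otimes>\<^bsub>G\<^esub> x = x \<otimes>\<^bsub>G\<^esub> g}\<rparr>"

text \<open>The trivial group counts as elementary abelian.\<close>

definition elementary_abelian :: "nat \<Rightarrow> ('a, 'b) monoid_scheme \<Rightarrow> bool" where
  "elementary_abelian p G \<longleftrightarrow>
    comm_group G \<and> (\<forall>x \<in> carrier G. x \<noteq> \<one>\<^bsub>G\<^esub> \<longrightarrow> group.ord G x = p)"

definition exponent :: "('a, 'b) monoid_scheme \<Rightarrow> nat" where
  "exponent G = (LEAST n::nat. n > 0 \<and> (\<forall>x \<in> carrier G. x [^]\<^bsub>G\<^esub> n = \<one>\<^bsub>G\<^esub>))"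

definition sylow_subgroup :: "nat \<Rightarrow> 'a set \<Rightarrow> ('a, 'b) monoid_scheme \<Rightarrow> bool" where
  "sylow_subgroup p P G \<longleftrightarrow> subgroup P G \<and> card P = p ^ multiplicity p (order G)"

definition internal_semidirect_product ::
    "('a, 'b) monoid_scheme \<Rightarrow> 'a set \<Rightarrow> 'a set \<Rightarrow> bool" where
  "internal_semidirect_product G N H \<longleftrightarrow>
    N \<lhd> G \<and> subgroup H G \<and> N \<inter> H = {\<one>\<^bsub>G\<^esub>} \<and> N <#>\<^bsub>G\<^esub> H = carrier G"

definition internal_direct_product ::
    "('a, 'b) monoid_scheme \<Rightarrow> 'a set \<Rightarrow> 'a set \<Rightarrow> bool" where
  "internal_direct_product G N H \<longleftrightarrow>
    N \<lhd> G \<and> H \<lhd> G \<and> N \<inter> H = {\<one>\<^bsub>G\<^esub>} \<and> N <#>\<^bsub>G\<^esub> H = carrier G"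

end

theory Submission
  imports Defs "HOL-Algebra.Sylow" "HOL-Number_Theory.Cong"
begin

text \<open>The power graph is \<open>C\<^sub>4\<close>-free only if any two cyclic subgroups whose intersection contains nontrivial
  elements of coprime orders are comparable. Put \<open>C = C\<^sub>G(x)\<close>. If \<open>w \<in> C\<close> had prime order different from
  \<open>p\<close> and \<open>q\<close>, then \<open>\<langle>x w z\<^sub>1\<rangle>\<close> and \<open>\<langle>x w z\<^sub>2\<rangle>\<close>, with \<open>z\<^sub>1, z\<^sub>2\<close> independent central elements of order \<open>p\<close>,
  would violate this. Now let \<open>|x| > q\<close>. A \<open>p\<close>-element \<open>u \<in> C\<close> has \<open>u\<^sup>p = 1\<close>, by comparing
  \<open>\<langle>x\<^sup>q u\<rangle>\<close> with \<open>\<langle>x u\<^sup>p\<rangle>\<close>. An element \<open>a \<in> C\<close> of order \<open>q\<close> lies in \<open>\<langle>x\<rangle>\<close>, by comparing \<open>\<langle>x z\<rangle>\<close> with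
  \<open>\<langle>x a z\<rangle>\<close> for a central \<open>z\<close> of order \<open>p\<close>; so the \<open>q\<close>-elements of \<open>C\<close> form one cyclic group \<open>\<langle>y\<rangle>\<close>
  containing \<open>x\<close>. A \<open>p\<close>-element of \<open>C\<close> normalizes \<open>\<langle>y\<rangle>\<close> and fixes \<open>x \<noteq> 1\<close>, hence centralizes \<open>\<langle>y\<rangle>\<close>. So \<open>C\<close> is
  always the direct product of its Sylow subgroups, and the second alternative in (2) is superfluous.\<close>

section \<open>Induced 4-cycles in simple graphs\<close>

lemma parcs_cycle_graph_4:
  "parcs (cycle_graph 4) = {(0,1),(1,0),(1,2),(2,1),(2,3),(3,2),(3,0),(0,3)}"
proof -
  have "parcs (cycle_graph 4) =
      set (filter (\<lambda>(i, j). j = (i + 1) mod 4 \<or> i = (j + 1) mod 4) (List.product [0..<4] [0..<4]))"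
    by (auto simp: cycle_graph_def)
  also have "[0..<4] = [0, 1, 2, 3]" by (simp add: upt_rec)
  finally show ?thesis by (simp add: insert_commute)
qed

text \<open>Going round \<open>a, s, c, t\<close> embeds the 4-cycle as an induced subgraph.
  Adjacent vertices are distinct because loops are excluded, so distinctness only has to be demanded
  across the two diagonals.\<close>

lemma C4_freeD:
  assumes free: "C4_free (with_proj \<Gamma>)"
    and wf: "wf_digraph (with_proj \<Gamma>)"
    and verts: "{a, s, c, t} \<subseteq> pverts \<Gamma>"
    and arcs: "{(a,s),(s,a),(s,c),(c,s),(c,t),(t,c),(t,a),(a,t)} \<subseteq> parcs \<Gamma>"
    and no_arcs: "(a,c) \<notin> parcs \<Gamma>" "(c,a) \<notin> parcs \<Gamma>" "(s,t) \<notin> parcs \<Gamma>" "(t,s) \<notin> parcs \<Gamma>"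
    and no_loops: "\<And>v. (v,v) \<notin> parcs \<Gamma>"
    and "a \<noteq> c" "s \<noteq> t"
  shows False
proof -
  define f :: "nat \<Rightarrow> 'a" where "f i = (if i = 0 then a else if i = 1 then s else if i = 2 then c else t)" for i
  have f: "f 0 = a" "f 1 = s" "f 2 = c" "f 3 = t" by (auto simp: f_def)
  define h where "h = \<lparr>iso_verts = f, iso_arcs = map_prod f f, iso_head = snd, iso_tail = fst\<rparr>"
  let ?C = "with_proj (cycle_graph 4)"
  have dist: "distinct [a, s, c, t]" using assms by auto
  have four: "{..<4} = {0, 1, 2, 3 :: nat}" by auto
  have inj: "inj_on f {..<4}" using dist unfolding four by (auto simp: inj_on_def f_def)
  have vC: "pverts (cycle_graph 4) = {..<4}" by (simp add: cycle_graph_def)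
  have sub: "parcs (cycle_graph 4) \<subseteq> {..<4} \<times> {..<4}" by (auto simp: cycle_graph_def)
  have wfC: "wf_digraph ?C"
    using sub by unfold_locales (auto simp: vC)
  have iso: "pre_digraph.digraph_isomorphism ?C h"
    unfolding pre_digraph.digraph_isomorphism_def
    using wfC inj inj_on_subset[OF map_prod_inj_on[OF inj inj] sub] by (simp add: h_def vC)
  have va: "verts (app_iso h ?C) = {a, s, c, t}"
    by (auto simp: h_def vC four f f(2)[simplified])
  have aa: "arcs (app_iso h ?C) = {(a,s),(s,a),(s,c),(c,s),(c,t),(t,c),(t,a),(a,t)}"
    by (simp add: h_def parcs_cycle_graph_4 f f(2)[simplified])
  have th: "tail (app_iso h ?C) = fst" "head (app_iso h ?C) = snd"
    by (simp_all add: h_def)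
  define S where "S = {(a,s),(s,a),(s,c),(c,s),(c,t),(t,c),(t,a),(a,t)}"
  define U where "U = {a,s,c,t}"
  \<comment> \<open>Of the sixteen pairs over \<open>U\<close>, the loops and the two diagonals in
    both directions are excluded, which leaves exactly the eight arcs of the cycle.\<close>
  have "(u,v) \<in> S" if "(u,v) \<in> parcs \<Gamma>" and u: "u \<in> U" and v: "v \<in> U" for u v
  proof -
    have "u \<noteq> v" using that(1) no_loops by metis
    moreover have "(u,v) \<noteq> (a,c)" "(u,v) \<noteq> (c,a)" "(u,v) \<noteq> (s,t)" "(u,v) \<noteq> (t,s)"
      using that(1) no_arcs by metis+
    ultimately show ?thesis
      using u v unfolding S_def U_def by (elim insertE emptyE) simp_all
  qed
  moreover have "S \<subseteq> parcs \<Gamma>" "S \<subseteq> U \<times> U"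
    unfolding S_def U_def using arcs by simp_all
  ultimately have "S = {e \<in> parcs \<Gamma>. fst e \<in> U \<and> snd e \<in> U}"
    by auto
  then have "arcs (app_iso h ?C) = {e \<in> parcs \<Gamma>. fst e \<in> {a,s,c,t} \<and> snd e \<in> {a,s,c,t}}"
    unfolding aa S_def U_def .
  moreover have "wf_digraph (app_iso h ?C)"
    using wf_digraph.wf_digraphI_app_iso[OF wfC iso] .
  ultimately have "induced_subgraph (app_iso h ?C) (with_proj \<Gamma>)"
    unfolding induced_subgraph_def subgraph_def compatible_def
    using wf verts arcs by (simp add: th va aa del: app_iso_simps)
  then show False
    using free iso unfolding C4_free_def digraph_iso_def by blast
qed

section \<open>Prime powers dividing \<open>s ^ n - 1\<close>\<close>

text \<open>In \<open>s ^ n - 1 = (s - 1) * (\<Sum>i<n. s ^ i)\<close> the sum is congruent to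
  \<open>n\<close> modulo \<open>q\<close>, hence prime to \<open>q\<close>, so the whole power of
  \<open>q\<close> divides the first factor.\<close>

lemma prime_power_dvd_minus_one:
  fixes s :: int and q n m :: nat
  assumes q: "prime q" and qs: "int q dvd s - 1" and qn: "\<not> q dvd n"
    and dvd: "int q ^ m dvd s ^ n - 1"
  shows "int q ^ m dvd s - 1"
proof -
  have "[s = 1] (mod int q)" using qs by (simp add: cong_iff_dvd_diff)
  then have "[s ^ i = 1] (mod int q)" for i
    using cong_pow[of s 1 "int q" i] by simp
  then have "[(\<Sum>i<n. s ^ i) = (\<Sum>i<n. 1)] (mod int q)"
    by (intro cong_sum) simp
  then have "\<not> int q dvd (\<Sum>i<n. s ^ i)"
    using qn cong_dvd_iff[of "\<Sum>i<n. s ^ i" "int n" "int q"] by simp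
  then have "coprime (int q ^ m) (\<Sum>i<n. s ^ i)"
    using q prime_imp_coprime[of "int q"] by simp
  moreover have "int q ^ m dvd (s - 1) * (\<Sum>i<n. s ^ i)"
    using dvd power_diff_1_eq[of s n] by simp
  ultimately show ?thesis using coprime_dvd_mult_left_iff by blast
qed

section \<open>Cyclic subgroups and their comparability\<close>

context group
begin

lemma mem_generate_iff:
  assumes "finite (carrier G)" "a \<in> carrier G"
  shows "w \<in> generate G {a} \<longleftrightarrow> (\<exists>k::nat. w = a [^] k)"
  using generate_pow_on_finite_carrier[OF assms] by auto

lemma generate_mono_elem:
  assumes "finite (carrier G)" "a \<in> carrier G" "w \<in> generate G {a}" "v \<in> generate G {w}"
  shows "v \<in> generate G {a}"
proof -
  obtain k :: nat where "w = a [^] k" using assms mem_generate_iff by blast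
  moreover obtain j :: nat where "v = w [^] j"
    using assms mem_generate_iff calculation by blast
  ultimately show ?thesis using assms mem_generate_iff by (auto simp: nat_pow_pow)
qed

lemma ord_dvd_if_mem_generate:
  assumes "finite (carrier G)" "a \<in> carrier G" "w \<in> generate G {a}"
  shows "ord w dvd ord a"
proof -
  obtain k :: nat where w: "w = a [^] k" using assms mem_generate_iff by blast
  have "w [^] ord a = (a [^] ord a) [^] k"
    using assms w by (simp only: nat_pow_pow mult.commute)
  then have "w [^] ord a = \<one>" using assms by simp
  then show ?thesis using w assms pow_eq_id by simp
qed

lemma mem_generate_if_same_ord:
  assumes "finite (carrier G)" "a \<in> carrier G" "w \<in> generate G {a}" "ord w = ord a"
  shows "a \<in> generate G {w}"
proof -
  have w: "w \<in> carrier G" using assms generate_in_carrier[of "{a}"] by auto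
  have sub: "generate G {w} \<subseteq> generate G {a}"
    using generate_mono_elem assms by blast
  have "generate G {w} = generate G {a}"
  proof (rule card_subset_eq[OF _ sub])
    show "finite (generate G {a})"
      using generate_incl[of "{a}"] assms finite_subset by auto
    show "card (generate G {w}) = card (generate G {a})"
      using assms w generate_pow_card by metis
  qed
  then show ?thesis using generate.incl[of a "{a}"] by simp
qed

text \<open>Otherwise \<open>a, s, c, t\<close> would be an induced 4-cycle.\<close>

lemma C4_free_comparable:
  assumes fin: "finite (carrier G)" and free: "C4_free (with_proj (power_graph G))"
    and a: "a \<in> carrier G" and c: "c \<in> carrier G"
    and s: "s \<in> generate G {a}" "s \<in> generate G {c}" "s \<noteq> \<one>"
    and t: "t \<in> generate G {a}" "t \<in> generate G {c}" "t \<noteq> \<one>"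
    and cop: "coprime (ord s) (ord t)"
  shows "a \<in> generate G {c} \<or> c \<in> generate G {a}"
proof (rule ccontr)
  assume neg: "\<not> ?thesis"
  have sc: "s \<in> carrier G" and tc: "t \<in> carrier G"
    using s t a generate_in_carrier[of "{a}"] by auto
  \<comment> \<open>Membership would make \<open>ord s\<close> a divisor of \<open>ord t\<close>; as
    the two are coprime, \<open>s\<close> would be trivial.\<close>
  have st: "s \<notin> generate G {t}"
    using ord_dvd_if_mem_generate[OF fin tc] cop s(3) sc
    by (metis coprime_absorb_left is_unit_gcd nat_dvd_1_iff_1 ord_eq_1)
  have ts: "t \<notin> generate G {s}"
    using ord_dvd_if_mem_generate[OF fin sc] cop t(3) tc
    by (metis coprime_absorb_right is_unit_gcd nat_dvd_1_iff_1 ord_eq_1)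
  \<comment> \<open>An equality such as \<open>s = a\<close> would put \<open>a\<close> into the
    subgroup generated by \<open>c\<close>, against \<open>neg\<close>.\<close>
  have ne: "s \<noteq> a" "s \<noteq> c" "t \<noteq> a" "t \<noteq> c" using s t neg by auto
  have self: "v \<in> generate G {v}" for v by (simp add: generate.incl)
  show False
  proof (rule C4_freeD[OF free])
    show "wf_digraph (with_proj (power_graph G))"
      by unfold_locales (auto simp: power_graph_def)
    show "{a, s, c, t} \<subseteq> pverts (power_graph G)"
      using a c sc tc by (simp add: power_graph_def)
    show "{(a,s),(s,a),(s,c),(c,s),(c,t),(t,c),(t,a),(a,t)} \<subseteq> parcs (power_graph G)"
      using a c sc tc s t ne by (auto simp: power_graph_def)
    show "a \<noteq> c" "s \<noteq> t" using neg st self by auto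
  qed (use neg st ts in \<open>auto simp: power_graph_def\<close>)
qed

section \<open>Splitting products of commuting elements of coprime orders\<close>

text \<open>The Chinese remainder theorem gives \<open>e\<close> congruent to 1 modulo
  \<open>n\<close> and to 0 modulo \<open>m\<close>. One \<open>e\<close> serves all elements of
  these orders, so that two different products can be projected simultaneously.\<close>

lemma obtain_projection_exponent:
  assumes "coprime n (m::nat)" "a \<in> carrier G" "b \<in> carrier G" "a \<otimes> b = b \<otimes> a"
    and "ord a dvd n" "ord b dvd m"
  obtains e :: nat where "(a \<otimes> b) [^] e = a" and "\<And>u. u \<in> carrier G \<Longrightarrow> ord u dvd n \<Longrightarrow> u [^] e = u"
    and "\<And>u. u \<in> carrier G \<Longrightarrow> ord u dvd m \<Longrightarrow> u [^] e = \<one>"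
proof -
  obtain e :: nat where e: "[e = 1] (mod n)" "[e = 0] (mod m)"
    using binary_chinese_remainder_nat[OF assms(1)] by blast
  have 1: "u [^] e = u" if "u \<in> carrier G" "ord u dvd n" for u
  proof -
    have "[int e = 1] (mod int (ord u))"
      using cong_dvd_modulus_nat[OF e(1) that(2)] cong_int_iff[of e 1 "ord u"] by simp
    then have "u [^] (int e) = u [^] (1::int)"
      using int_pow_eq[OF that(1)] by (simp add: cong_iff_dvd_diff dvd_diff_commute)
    then show ?thesis using that by (simp add: int_pow_int)
  qed
  have 2: "u [^] e = \<one>" if "u \<in> carrier G" "ord u dvd m" for u
    using that e(2) pow_eq_id by (metis cong_0_iff dvd_trans)
  have "(a \<otimes> b) [^] e = a"
    using pow_mult_distrib[OF assms(4,2,3)] 1 2 assms by simp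
  then show ?thesis using that 1 2 by blast
qed

lemma factors_mem_generate_mult:
  assumes fin: "finite (carrier G)" and cop: "coprime (ord a) (ord b)"
    and ab: "a \<in> carrier G" "b \<in> carrier G" "a \<otimes> b = b \<otimes> a"
  shows "a \<in> generate G {a \<otimes> b}" "b \<in> generate G {a \<otimes> b}"
proof -
  have key: "u \<in> generate G {u \<otimes> v}"
    if h: "coprime (ord u) (ord v)" "u \<in> carrier G" "v \<in> carrier G" "u \<otimes> v = v \<otimes> u" for u v
  proof -
    obtain e :: nat where "(u \<otimes> v) [^] e = u"
      using obtain_projection_exponent[OF h dvd_refl dvd_refl] by blast
    then show ?thesis using mem_generate_iff[OF fin, of "u \<otimes> v"] h by (metis m_closed)
  qed
  show "a \<in> generate G {a \<otimes> b}" by (rule key[OF cop ab])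
  show "b \<in> generate G {a \<otimes> b}"
    using key[of b a] cop ab by (simp add: coprime_commute)
qed

text \<open>Raising \<open>a \<otimes> b = (c \<otimes> d) [^] k\<close> to the projection exponent
  turns it into \<open>a = c [^] k\<close>; the other factor is symmetric.\<close>

lemma mult_mem_generate_mult:
  assumes fin: "finite (carrier G)" and cop: "coprime n (m::nat)"
    and ab: "a \<in> carrier G" "b \<in> carrier G" "a \<otimes> b = b \<otimes> a" "ord a dvd n" "ord b dvd m"
    and cd: "c \<in> carrier G" "d \<in> carrier G" "c \<otimes> d = d \<otimes> c" "ord c dvd n" "ord d dvd m"
    and mem: "a \<otimes> b \<in> generate G {c \<otimes> d}"
  shows "a \<in> generate G {c}" "b \<in> generate G {d}"
proof -
  have key: "u \<in> generate G {v}"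
    if h: "coprime n (m::nat)" "u \<in> carrier G" "w \<in> carrier G" "u \<otimes> w = w \<otimes> u" "ord u dvd n" "ord w dvd m"
    "v \<in> carrier G" "z \<in> carrier G" "v \<otimes> z = z \<otimes> v" "ord v dvd n" "ord z dvd m"
    "u \<otimes> w \<in> generate G {v \<otimes> z}" for u v w z n m
  proof -
    obtain e :: nat where e: "(u \<otimes> w) [^] e = u"
       "\<And>u. u \<in> carrier G \<Longrightarrow> ord u dvd n \<Longrightarrow> u [^] e = u"
       "\<And>u. u \<in> carrier G \<Longrightarrow> ord u dvd m \<Longrightarrow> u [^] e = \<one>"
      using obtain_projection_exponent[OF h(1-6)] by blast
    obtain k :: nat where k: "u \<otimes> w = (v \<otimes> z) [^] k"
      using h mem_generate_iff[OF fin] by blast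
    have "u = ((v \<otimes> z) [^] e) [^] k"
      using e(1) k that by (simp add: nat_pow_pow mult.commute)
    also have "(v \<otimes> z) [^] e = v"
      using e that pow_mult_distrib[of v z e] by simp
    finally show ?thesis using mem_generate_iff[OF fin] that by blast
  qed
  show "a \<in> generate G {c}" by (rule key[OF cop ab cd mem])
  show "b \<in> generate G {d}"
    using key[of m n b a d c] cop ab cd mem by (simp add: coprime_commute)
qed

section \<open>Orders in subgroups and Cauchy's theorem\<close>

lemma ord_consistent:
  assumes "subgroup H G" "x \<in> H"
  shows "group.ord (G\<lparr>carrier := H\<rparr>) x = ord x"
proof -
  have H: "group (G\<lparr>carrier := H\<rparr>)" using assms(1) by (rule subgroup_imp_group)
  have x: "x \<in> carrier G" using assms subgroup.mem_carrier by metis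
  show ?thesis
    using group.ord_unique[OF H, of x "ord x"] assms(2) pow_eq_id[OF x]
    by (simp add: nat_pow_consistent[symmetric])
qed

lemma ord_dvd_card_subgroup:
  assumes "subgroup H G" "x \<in> H"
  shows "ord x dvd card H"
  using group.ord_dvd_group_order[OF subgroup_imp_group[OF assms(1)], of x] assms
  by (simp add: ord_consistent order_def)

text \<open>Cauchy's theorem: Sylow's theorem for the prime power \<open>r ^ 1\<close> yields a
  subgroup of order \<open>r\<close>, and each of its nontrivial elements has order
  \<open>r\<close>.\<close>

lemma exists_ord_eq_prime:
  assumes fin: "finite (carrier G)" and H: "subgroup H G" and r: "prime r" "r dvd card H"
  shows "\<exists>w \<in> H. ord w = r"
proof -
  obtain m where "card H = r ^ 1 * m" using r by auto
  then obtain K where K: "subgroup K (G\<lparr>carrier := H\<rparr>)" "card K = r"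
    using sylow_thm[OF r(1) subgroup_imp_group[OF H], of 1 m] finite_subset[OF subgroup.subset[OF H] fin]
    by (auto simp: order_def)
  have KG: "subgroup K G" using incl_subgroup[OF H K(1)] .
  have "\<not> K \<subseteq> {\<one>}"
    using K(2) prime_gt_1_nat[OF r(1)] card_mono[of "{\<one>}" K] by auto
  then obtain w where w: "w \<in> K" "w \<noteq> \<one>" by blast
  have "ord w dvd r" using ord_dvd_card_subgroup[OF KG w(1)] K(2) by simp
  moreover have "ord w \<noteq> 1" using w KG ord_eq_1 subgroup.mem_carrier by metis
  ultimately have "ord w = r" using r(1) prime_nat_iff by blast
  moreover have "w \<in> H" using subgroup.subset[OF K(1)] w(1) by auto
  ultimately show ?thesis by blast
qed

section \<open>Conjugation on a cyclic \<open>q\<close>-group\<close>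

lemma conj_pow:
  assumes "u \<in> carrier G" "y \<in> carrier G"
  shows "(u \<otimes> y \<otimes> inv u) [^] (i::nat) = u \<otimes> y [^] i \<otimes> inv u"
proof (induction i)
  case (Suc i)
  have "inv u \<otimes> (u \<otimes> (y \<otimes> inv u)) = y \<otimes> inv u"
    using assms by (simp flip: m_assoc)
  then show ?case using Suc assms by (simp add: m_assoc)
qed (use assms in simp)

lemma ord_conj:
  assumes "u \<in> carrier G" "y \<in> carrier G"
  shows "ord (u \<otimes> y \<otimes> inv u) = ord y"
proof -
  have "w = \<one>" if "w \<in> carrier G" "u \<otimes> w \<otimes> inv u = \<one>" for w
  proof -
    have "w = inv u \<otimes> (u \<otimes> w \<otimes> inv u) \<otimes> u"
      using that(1) assms by (simp add: m_assoc) (simp flip: m_assoc)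
    then show ?thesis using that(2) assms by simp
  qed
  then have "u \<otimes> w \<otimes> inv u = \<one> \<longleftrightarrow> w = \<one>" if "w \<in> carrier G" for w
    using assms that by auto
  then show ?thesis
    using ord_unique[of "u \<otimes> y \<otimes> inv u" "ord y"] assms by (simp add: conj_pow pow_eq_id)
qed

text \<open>The automorphism of \<open>\<langle>y\<rangle>\<close> induced by \<open>u\<close> is \<open>y \<mapsto> y\<^sup>s\<close>; it fixes the nontrivial element \<open>y [^] i\<close>,
  so \<open>s \<equiv> 1 (mod q)\<close>, and its order is prime to \<open>q\<close>, so \<open>s \<equiv> 1 (mod q\<^sup>m)\<close>.\<close>

lemma coprime_conj_commutes:
  assumes fin: "finite (carrier G)" and q: "prime q" "\<not> q dvd n"
    and u: "u \<in> carrier G" "u [^] n = \<one>" and y: "y \<in> carrier G" "ord y = q ^ m"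
    and conj: "u \<otimes> y \<otimes> inv u \<in> generate G {y}"
    and x: "x \<in> generate G {y}" "x \<noteq> \<one>" "u \<otimes> x = x \<otimes> u"
  shows "u \<otimes> y = y \<otimes> u"
proof -
  obtain s :: nat where s: "u \<otimes> y \<otimes> inv u = y [^] s"
    using conj mem_generate_iff[OF fin y(1)] by blast
  obtain i :: nat where i: "x = y [^] i"
    using x mem_generate_iff[OF fin y(1)] by blast
  have pow_eq: "y [^] (a::nat) = y [^] (b::nat) \<longleftrightarrow> int q ^ m dvd int a - int b" for a b
    using int_pow_eq[OF y(1), of "int a" "int b"] y(2)
    by (simp add: int_pow_int dvd_diff_commute)
  \<comment> \<open>Conjugation by \<open>u\<close> sends \<open>x = y [^] i\<close> to
    \<open>y [^] (s * i)\<close>, but it also fixes \<open>x\<close>.\<close>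
  have "y [^] (s * i) = u \<otimes> x \<otimes> inv u"
    using conj_pow[OF u(1) y(1), of i] s i y(1) by (simp add: nat_pow_pow)
  also have "\<dots> = y [^] i"
    using x(3) u(1) y(1) i by (simp add: m_assoc)
  finally have "int q ^ m dvd (int s - 1) * int i"
    using pow_eq by (simp add: algebra_simps)
  moreover have "\<not> int q ^ m dvd int i"
    using x(2) i pow_eq[of i 0] by simp
  \<comment> \<open>Otherwise \<open>q ^ m\<close> would divide \<open>i\<close>, which means
    \<open>x = \<one>\<close>.\<close>
  ultimately have "\<not> coprime (int q ^ m) (int s - 1)"
    using coprime_dvd_mult_right_iff by blast
  then have qs: "int q dvd int s - 1"
    using q(1) prime_imp_coprime[of "int q" "int s - 1"] by auto
  have "u [^] j \<otimes> y \<otimes> inv (u [^] j) = y [^] (s ^ j)" for j :: nat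
  proof (induction j)
    case (Suc j)
    have "u [^] Suc j \<otimes> y \<otimes> inv (u [^] Suc j) = u [^] j \<otimes> (u \<otimes> y \<otimes> inv u) \<otimes> inv (u [^] j)"
      using u y by (simp add: inv_mult_group m_assoc)
    also have "\<dots> = (y [^] (s ^ j)) [^] s"
      using conj_pow[of "u [^] j" y s] Suc s u y by simp
    finally show ?case using y by (simp add: nat_pow_pow mult.commute)
  qed (use y in simp)
  \<comment> \<open>Conjugation by \<open>u [^] n = \<one>\<close> is the identity, so
    \<open>s ^ n\<close> is congruent to 1 modulo \<open>q ^ m\<close>.\<close>
  from this[of n] have "y [^] (s ^ n) = y [^] (1::nat)" using u y by simp
  then have "int q ^ m dvd int s ^ n - 1" using iffD1[OF pow_eq, of "s ^ n" 1] by simp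
  then have "int q ^ m dvd int s - 1"
    using prime_power_dvd_minus_one[OF q(1) qs q(2)] by blast
  then have "y [^] s = y" using pow_eq[of s 1] y(1) by simp
  then show ?thesis using s u(1) y(1) by (metis inv_closed inv_solve_right m_closed)
qed

section \<open>Direct products, centralizers, the center and exponents\<close>

text \<open>An element of both subgroups has order 1 by coprimality, so products
  \<open>u \<otimes> v\<close> are pairwise distinct and exhaust the group by counting. Commutation
  then makes both factors normal.\<close>

lemma internal_direct_product_if_coprime_commuting:
  assumes fin: "finite (carrier G)" and P: "subgroup P G" and Q: "subgroup Q G"
    and cop: "coprime (card P) (card Q)" and order: "card P * card Q = order G"
    and comm: "\<And>u v. u \<in> P \<Longrightarrow> v \<in> Q \<Longrightarrow> u \<otimes> v = v \<otimes> u"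
  shows "internal_direct_product G P Q"
proof -
  interpret group_disjoint_sum G P Q
    using P Q by (simp add: group_disjoint_sum_def is_group)
  have "u = \<one>" if "u \<in> P" "u \<in> Q" for u
  proof -
    have "ord u dvd card P" "ord u dvd card Q"
      using that P Q ord_dvd_card_subgroup by auto
    then have "ord u = 1" using cop coprime_common_divisor_nat by blast
    then show ?thesis using that P ord_eq_1 subgroup.mem_carrier by metis
  qed
  then have triv: "P \<inter> Q \<subseteq> {\<one>}" by blast
  have "inj_on (\<lambda>(u, v). u \<otimes> v) (P \<times> Q)"
    using triv[unfolded cancel] by (auto simp: inj_on_def)
  then have "card ((\<lambda>(u, v). u \<otimes> v) ` (P \<times> Q)) = order G"
    using order by (simp add: card_image card_cartesian_product)
  moreover have "(\<lambda>(u, v). u \<otimes> v) ` (P \<times> Q) = P <#> Q"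
    by (auto simp: set_mult_def)
  moreover have "P <#> Q \<subseteq> carrier G"
    using P Q by (simp add: set_mult_closed subgroup.subset)
  ultimately have "P <#> Q = carrier G"
    using card_subset_eq[OF fin] by (simp add: order_def)
  then show ?thesis
    unfolding internal_direct_product_def
    using commuting_imp_normal1 commuting_imp_normal2 comm triv subset_one by auto
qed

lemma subgroup_centralizer:
  assumes "x \<in> carrier G"
  shows "subgroup (carrier (centralizer G x)) G"
proof (rule subgroupI)
  show "inv a \<in> carrier (centralizer G x)" if "a \<in> carrier (centralizer G x)" for a
  proof -
    have a: "a \<in> carrier G" "a \<otimes> x = x \<otimes> a" using that by (auto simp: centralizer_def)
    have "inv a \<otimes> x = inv a \<otimes> (x \<otimes> a) \<otimes> inv a" using a(1) assms by (simp add: m_assoc)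
    also have "\<dots> = inv a \<otimes> (a \<otimes> x) \<otimes> inv a" by (simp only: a(2))
    also have "\<dots> = x \<otimes> inv a" using a(1) assms by (simp flip: m_assoc)
    finally show ?thesis using a(1) by (simp add: centralizer_def)
  qed
  show "a \<otimes> b \<in> carrier (centralizer G x)"
    if "a \<in> carrier (centralizer G x)" "b \<in> carrier (centralizer G x)" for a b
    using that assms unfolding centralizer_def by simp (metis m_assoc)
qed (use assms in \<open>auto simp: centralizer_def\<close>)

text \<open>A nontrivial central \<open>z1\<close> generates only \<open>p\<close> elements, so some
  central \<open>z2\<close> lies outside. Since both orders are \<open>p\<close>, \<open>z1\<close>
  is then outside the subgroup of \<open>z2\<close> as well.\<close>

lemma elementary_abelian_center_independent:
  assumes fin: "finite (carrier G)" and p: "prime p"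
    and Z: "elementary_abelian p (center G)" "order (center G) > p"
  obtains z1 z2 where "z1 \<in> carrier G" "z2 \<in> carrier G" "ord z1 = p" "ord z2 = p"
    "\<And>g. g \<in> carrier G \<Longrightarrow> z1 \<otimes> g = g \<otimes> z1" "\<And>g. g \<in> carrier G \<Longrightarrow> z2 \<otimes> g = g \<otimes> z2"
    "z1 \<notin> generate G {z2}" "z2 \<notin> generate G {z1}"
proof -
  define C where "C = carrier (center G)"
  have CG: "center G = G\<lparr>carrier := C\<rparr>" by (simp add: C_def center_def)
  have C: "C \<subseteq> carrier G" "\<And>z g. z \<in> C \<Longrightarrow> g \<in> carrier G \<Longrightarrow> z \<otimes> g = g \<otimes> z"
    by (auto simp: C_def center_def)
  \<comment> \<open>That the center is a subgroup is read off from the \<open>comm_group\<close>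
    condition in \<open>elementary_abelian\<close>.\<close>
  have "group (G\<lparr>carrier := C\<rparr>)"
    using Z(1) unfolding elementary_abelian_def CG by (simp add: comm_group_def)
  then have sub: "subgroup C G" by (rule group_incl_imp_subgroup[OF C(1)])
  have ordp: "ord z = p" if "z \<in> C" "z \<noteq> \<one>" for z
    using Z(1) that ord_consistent[OF sub that(1)] unfolding elementary_abelian_def CG by simp
  have card: "p < card C" using Z(2) by (simp add: CG order_def)
  have "\<not> C \<subseteq> {\<one>}"
    using card prime_gt_0_nat[OF p] card_mono[of "{\<one>}" C] by auto
  then obtain z1 where z1: "z1 \<in> C" "z1 \<noteq> \<one>" by blast
  have z1G: "z1 \<in> carrier G" using z1 C by blast
  have "card (generate G {z1}) = p"
    using generate_pow_card[OF z1G] ordp[OF z1] by simp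
  moreover have "finite (generate G {z1})"
    using generate_incl[of "{z1}"] z1G finite_subset[OF _ fin] by simp
  ultimately have "\<not> C \<subseteq> generate G {z1}"
    using card card_mono[of "generate G {z1}" C] by auto
  then obtain z2 where z2: "z2 \<in> C" "z2 \<notin> generate G {z1}" by blast
  have z2G: "z2 \<in> carrier G" using z2 C by blast
  have "z2 \<noteq> \<one>" using z2(2) generate.one[of G] by auto
  then have o: "ord z1 = p" "ord z2 = p" using ordp z1 z2 by auto
  have "z1 \<notin> generate G {z2}"
    using mem_generate_if_same_ord[OF fin z2G, of z1] o z2(2) by auto
  then show thesis using that[of z1 z2] z1G z2G o C(2) z1(1) z2 by blast
qed

text \<open>Some nontrivial element exists and has order exactly \<open>p\<close>, so every positive
  \<open>n\<close> annihilating \<open>P\<close> is a multiple of \<open>p\<close>.\<close>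

lemma exponent_subgroup_eq_prime:
  assumes P: "subgroup P G" "P \<noteq> {\<one>}" and p: "prime p" "\<And>u. u \<in> P \<Longrightarrow> u [^] p = \<one>"
  shows "exponent (G\<lparr>carrier := P\<rparr>) = p"
  unfolding exponent_def
proof (rule Least_equality)
  show "0 < p \<and> (\<forall>u\<in>carrier (G\<lparr>carrier := P\<rparr>). u [^]\<^bsub>G\<lparr>carrier := P\<rparr>\<^esub> p = \<one>\<^bsub>G\<lparr>carrier := P\<rparr>\<^esub>)"
    using p prime_gt_0_nat by (simp add: nat_pow_consistent[symmetric])
next
  fix n :: nat
  assume n: "0 < n \<and> (\<forall>u\<in>carrier (G\<lparr>carrier := P\<rparr>). u [^]\<^bsub>G\<lparr>carrier := P\<rparr>\<^esub> n = \<one>\<^bsub>G\<lparr>carrier := P\<rparr>\<^esub>)"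
  obtain u where u: "u \<in> P" "u \<noteq> \<one>" using P subgroup.one_closed[OF P(1)] by blast
  have uG: "u \<in> carrier G" using u(1) subgroup.mem_carrier[OF P(1)] by simp
  have "ord u dvd p" using pow_eq_id[OF uG] p(2)[OF u(1)] by simp
  moreover have "ord u \<noteq> 1" using ord_eq_1[OF uG] u(2) by simp
  ultimately have "ord u = p" using p(1) prime_nat_iff by blast
  moreover have "u [^] n = \<one>" using n u(1) by (simp add: nat_pow_consistent[symmetric])
  ultimately show "p \<le> n" using pow_eq_id[OF uG] n dvd_imp_le by blast
qed

lemma cyclic_group_generate:
  assumes "y \<in> carrier G"
  shows "cyclic_group (G\<lparr>carrier := generate G {y}\<rparr>)"
proof -
  have sub: "subgroup (generate G {y}) G" using assms by (intro generate_is_subgroup) simp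
  have y: "y \<in> generate G {y}" by (simp add: generate.incl)
  have "generate G {y} = range (\<lambda>n::int. y [^]\<^bsub>G\<lparr>carrier := generate G {y}\<rparr>\<^esub> n)"
    using generate_pow[OF assms] int_pow_consistent[OF sub y] by (simp add: full_SetCompr_eq)
  then show ?thesis
    using group.cyclic_group[OF subgroup_imp_group[OF sub]] y by auto
qed

end

section \<open>Consequences of a \<open>C4_free\<close> power graph\<close>

locale C4_free_group = group +
  assumes fin: "finite (carrier G)" and C4_free: "C4_free (with_proj (power_graph G))"
begin

text \<open>A single common element \<open>s\<close> of the two cyclic subgroups does not yet give a
  4-cycle. Multiplying both generators by \<open>z\<close> supplies the second common element, of
  order prime to \<open>ord s\<close>, and comparability of the products projects back to
  \<open>a\<close> and \<open>b\<close>.\<close>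

lemma comparable_if_common_multiplier:
  assumes a: "a \<in> carrier G" "a \<otimes> z = z \<otimes> a" "coprime (ord a) (ord z)"
    and b: "b \<in> carrier G" "b \<otimes> z = z \<otimes> b" "coprime (ord b) (ord z)"
    and z: "z \<in> carrier G" "z \<noteq> \<one>"
    and s: "s \<in> generate G {a}" "s \<in> generate G {b}" "s \<noteq> \<one>"
  shows "a \<in> generate G {b} \<or> b \<in> generate G {a}"
proof -
  note faz = factors_mem_generate_mult[OF fin a(3,1) z(1) a(2)]
  note fbz = factors_mem_generate_mult[OF fin b(3,1) z(1) b(2)]
  have az: "a \<otimes> z \<in> carrier G" and bz: "b \<otimes> z \<in> carrier G" using a b z by auto
  have "coprime (ord s) (ord z)"
    using coprime_divisors[OF ord_dvd_if_mem_generate[OF fin a(1) s(1)] dvd_refl a(3)] .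
  then have "a \<otimes> z \<in> generate G {b \<otimes> z} \<or> b \<otimes> z \<in> generate G {a \<otimes> z}"
    using C4_free_comparable[OF fin C4_free az bz, of s z] s(3) z(2) faz(2) fbz(2)
      generate_mono_elem[OF fin az faz(1) s(1)] generate_mono_elem[OF fin bz fbz(1) s(2)] by blast
  \<comment> \<open>The modulus \<open>ord a * ord b\<close> is a multiple of both orders, so one
    projection handles \<open>a\<close> and \<open>b\<close> together.\<close>
  moreover have cop: "coprime (ord a * ord b) (ord z)" using a(3) b(3) by simp
  ultimately show ?thesis
    using mult_mem_generate_mult(1)[OF fin cop a(1) z(1) a(2) _ _ b(1) z(1) b(2)]
      mult_mem_generate_mult(1)[OF fin cop b(1) z(1) b(2) _ _ a(1) z(1) a(2)] by auto
qed

text \<open>The subgroups generated by \<open>x \<otimes> w \<otimes> z1\<close> and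
  \<open>x \<otimes> w \<otimes> z2\<close> share \<open>x\<close> and \<open>w\<close>, which have
  coprime orders. Hence they are comparable, and so are their projections to the
  \<open>m\<close>-part.\<close>

lemma coprime_triple_comparable:
  assumes x: "x \<in> carrier G" "x \<noteq> \<one>" and w: "w \<in> carrier G" "w \<noteq> \<one>" "x \<otimes> w = w \<otimes> x"
    and cop: "coprime (ord x) (ord w)" "coprime (ord x * ord w) m"
    and z: "z1 \<in> carrier G" "z2 \<in> carrier G" "ord z1 dvd m" "ord z2 dvd m"
      "\<And>g. g \<in> carrier G \<Longrightarrow> z1 \<otimes> g = g \<otimes> z1" "\<And>g. g \<in> carrier G \<Longrightarrow> z2 \<otimes> g = g \<otimes> z2"
  shows "z1 \<in> generate G {z2} \<or> z2 \<in> generate G {z1}"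
proof -
  define v where "v = x \<otimes> w"
  have v: "v \<in> carrier G" "ord v dvd ord x * ord w"
    unfolding v_def using x w ord_mul_divides by auto
  have mem: "x \<in> generate G {v \<otimes> z} \<and> w \<in> generate G {v \<otimes> z}"
    if "z \<in> carrier G" "ord z dvd m" "v \<otimes> z = z \<otimes> v" for z
  proof -
    have "coprime (ord v) (ord z)" using coprime_divisors[OF v(2) that(2) cop(2)] .
    then have "v \<in> generate G {v \<otimes> z}"
      using factors_mem_generate_mult(1)[OF fin _ v(1) that(1,3)] by blast
    then show ?thesis
      using generate_mono_elem[OF fin, of "v \<otimes> z" v] v(1) that(1)
        factors_mem_generate_mult[OF fin cop(1) x(1) w(1,3)] unfolding v_def by auto
  qed
  have c: "v \<otimes> z1 = z1 \<otimes> v" "v \<otimes> z2 = z2 \<otimes> v" using z(5,6) v(1) by auto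
  have "v \<otimes> z1 \<in> generate G {v \<otimes> z2} \<or> v \<otimes> z2 \<in> generate G {v \<otimes> z1}"
    using C4_free_comparable[OF fin C4_free, of "v \<otimes> z1" "v \<otimes> z2" x w]
      mem[OF z(1,3) c(1)] mem[OF z(2,4) c(2)] v(1) z(1,2) x(2) w(2) cop(1) by auto
  then show ?thesis
    using mult_mem_generate_mult(2)[OF fin cop(2) v(1) z(1) c(1) v(2) z(3) v(1) z(2) c(2) v(2) z(4)]
      mult_mem_generate_mult(2)[OF fin cop(2) v(1) z(2) c(2) v(2) z(4) v(1) z(1) c(1) v(2) z(3)]
    by blast
qed

text \<open>If \<open>u [^] p\<close> were nontrivial, the subgroups generated by
  \<open>x [^] q \<otimes> u\<close> and \<open>x \<otimes> u [^] p\<close> would share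
  \<open>x [^] q\<close> and \<open>u [^] p\<close>. Comparability would put \<open>u\<close> into
  the subgroup of \<open>u [^] p\<close> or \<open>x\<close> into that of \<open>x [^] q\<close>,
  where orders are too small.\<close>

lemma pow_prime_eq_one_if_commutes:
  assumes p: "prime p" and q: "prime q" and cop: "coprime (ord x) (ord u)"
    and x: "x \<in> carrier G" "q dvd ord x" "ord x > q"
    and u: "u \<in> carrier G" "p dvd ord u" "x \<otimes> u = u \<otimes> x"
  shows "u [^] p = \<one>"
proof (rule ccontr)
  assume up: "u [^] p \<noteq> \<one>"
  \<comment> \<open>This is where \<open>ord x > q\<close> enters.\<close>
  have xq: "x [^] q \<noteq> \<one>" 
    using pow_eq_id[OF x(1), of q] dvd_imp_le[of "ord x" q] x(3) prime_gt_0_nat[OF q] by auto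
  have not_mem: "g \<notin> generate G {g [^] r}" if "g \<in> carrier G" "prime r" "r dvd ord g" for g r
  proof
    assume "g \<in> generate G {g [^] r}"
    then have "ord g dvd ord g div r"
      using ord_dvd_if_mem_generate[OF fin, of "g [^] r" g] ord_pow[OF that(1,3)] that by auto
    moreover have "0 < ord g" using ord_ge_1[OF fin that(1)] by simp
    moreover have "ord g div r < ord g"
      using \<open>0 < ord g\<close> prime_gt_1_nat[OF that(2)] by simp
    moreover have "0 < ord g div r"
      using \<open>0 < ord g\<close> that(3) by (simp add: dvd_imp_le div_greater_zero_iff prime_gt_0_nat[OF that(2)])
    ultimately show False using dvd_imp_le by fastforce
  qed
  have dvds: "ord (x [^] q) dvd ord x" "ord (u [^] p) dvd ord u"
    using x(1) u(1) ord_dvd_if_mem_generate[OF fin] mem_generate_iff[OF fin] by blast+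
  have comm: "x [^] q \<otimes> u = u \<otimes> x [^] q" "x \<otimes> u [^] p = u [^] p \<otimes> x"
    using group_commutes_pow[OF u(3) x(1) u(1), of q] group_commutes_pow[OF u(3)[symmetric] u(1) x(1), of p]
    by simp_all
  have cops: "coprime (ord (x [^] q)) (ord u)" "coprime (ord x) (ord (u [^] p))"
     "coprime (ord (x [^] q)) (ord (u [^] p))"
    using coprime_divisors[OF dvds(1) dvd_refl cop] coprime_divisors[OF dvd_refl dvds(2) cop]
      coprime_divisors[OF dvds cop] by simp_all
  let ?a = "x [^] q \<otimes> u" and ?c = "x \<otimes> u [^] p"
  have car: "?a \<in> carrier G" "?c \<in> carrier G" using x(1) u(1) by auto
  note fa = factors_mem_generate_mult[OF fin cops(1) nat_pow_closed[OF x(1)] u(1) comm(1)]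
  note fc = factors_mem_generate_mult[OF fin cops(2) x(1) nat_pow_closed[OF u(1)] comm(2)]
  have "x [^] q \<in> generate G {?c}" "u [^] p \<in> generate G {?a}"
    using generate_mono_elem[OF fin car(2) fc(1)] generate_mono_elem[OF fin car(1) fa(2)]
      mem_generate_iff[OF fin] x(1) u(1) by blast+
  then have "?a \<in> generate G {?c} \<or> ?c \<in> generate G {?a}"
    using C4_free_comparable[OF fin C4_free car, of "x [^] q" "u [^] p"] fa(1) fc(2) xq up cops(3)
    by blast
  then show False
    using mult_mem_generate_mult(2)[OF fin cop nat_pow_closed[OF x(1)] u(1) comm(1) dvds(1) dvd_refl
        x(1) nat_pow_closed[OF u(1)] comm(2) dvd_refl dvds(2)]
      mult_mem_generate_mult(1)[OF fin cop x(1) nat_pow_closed[OF u(1)] comm(2) dvd_refl dvds(2)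
        nat_pow_closed[OF x(1)] u(1) comm(1) dvds(1) dvd_refl]
      not_mem[OF u(1) p u(2)] not_mem[OF x(1) q x(2)] by blast
qed

section \<open>The \<open>q\<close>-elements commuting with \<open>x\<close>, compared by means of a
  central \<open>z\<close>\<close>

context
  fixes z x q k
  assumes z: "z \<in> carrier G" "z \<noteq> \<one>" "\<And>g. g \<in> carrier G \<Longrightarrow> g \<otimes> z = z \<otimes> g"
    and q: "prime q" "coprime q (ord z)"
    and x: "x \<in> carrier G" "ord x = q ^ k" "ord x > q"
begin

text \<open>Since \<open>(x \<otimes> a) [^] q = x [^] q\<close> is nontrivial, \<open>x\<close> and
  \<open>x \<otimes> a\<close> generate comparable subgroups. In either direction
  \<open>x \<otimes> a\<close> is a power of \<open>x\<close>, and then so is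
  \<open>a\<close>.\<close>

lemma order_q_mem_generate:
  assumes a: "a \<in> carrier G" "x \<otimes> a = a \<otimes> x" "ord a = q"
  shows "a \<in> generate G {x}"
proof -
  have xa: "x \<otimes> a \<in> carrier G" using x a by simp
  \<comment> \<open>A positive \<open>k\<close> makes \<open>ord a = q\<close> divide
    \<open>q ^ k\<close>.\<close>
  have "k \<noteq> 0" using x(2,3) prime_gt_1_nat[OF q(1)] by (intro notI) simp
  then have "x [^] (q ^ k) = \<one>" "a [^] (q ^ k) = \<one>"
    using pow_eq_id[OF x(1)] pow_eq_id[OF a(1)] x(2) a(3) by simp_all
  then have "(x \<otimes> a) [^] (q ^ k) = \<one>"
    using pow_mult_distrib[OF a(2) x(1) a(1)] by simp
  then have dvd: "ord (x \<otimes> a) dvd q ^ k" using xa pow_eq_id by simp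
  have "(x \<otimes> a) [^] q = x [^] q"
    using pow_mult_distrib[OF a(2) x(1) a(1)] x(1) a(1,3) pow_ord_eq_1[OF a(1)] by simp
  then have s: "x [^] q \<in> generate G {x}" "x [^] q \<in> generate G {x \<otimes> a}"
    using mem_generate_iff[OF fin] x(1) xa by metis+
  have s1: "x [^] q \<noteq> \<one>" 
    using pow_eq_id[OF x(1), of q] dvd_imp_le[of "ord x" q] x(3) prime_gt_0_nat[OF q(1)] by auto
  have cop: "coprime (q ^ k) (ord z)" using q(2) by simp
  have "coprime (ord (x \<otimes> a)) (ord z)" using coprime_divisors[OF dvd dvd_refl cop] .
  then consider "x \<in> generate G {x \<otimes> a}" | "x \<otimes> a \<in> generate G {x}"
    using comparable_if_common_multiplier[OF x(1) z(3) _ xa z(3) _ z(1,2) s s1] x(1,2) xa cop by auto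
  then have "x \<otimes> a \<in> generate G {x}"
  proof cases
    \<comment> \<open>The orders of \<open>x\<close> and \<open>x \<otimes> a\<close> divide each
      other, so the inclusion of cyclic subgroups is an equality.\<close>
    case 1
    then have "ord x = ord (x \<otimes> a)"
      using ord_dvd_if_mem_generate[OF fin xa] dvd x(2) dvd_antisym by metis
    then show ?thesis using mem_generate_if_same_ord[OF fin xa 1] by simp
  qed
  moreover have "subgroup (generate G {x}) G" using generate_is_subgroup x(1) by simp
  moreover have "x \<in> generate G {x}" by (simp add: generate.incl)
  ultimately have "inv x \<otimes> (x \<otimes> a) \<in> generate G {x}"
    using subgroup.m_closed subgroup.m_inv_closed by metis
  then show ?thesis using x(1) a(1) by (simp flip: m_assoc)
qed

text \<open>A nontrivial \<open>a\<close> has a power \<open>b\<close> of order \<open>q\<close>,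
  which is also a power of \<open>x\<close>. It serves as the common element of the two
  subgroups.\<close>

lemma primary_comparable:
  assumes a: "a \<in> carrier G" "x \<otimes> a = a \<otimes> x" "ord a = q ^ j"
  shows "a \<in> generate G {x} \<or> x \<in> generate G {a}"
proof (cases "a = \<one>")
  case True
  then show ?thesis using generate.one[of G] by simp
next
  case False
  then have j: "j \<noteq> 0" using a(1,3) ord_eq_1 by (intro notI) simp
  define b where "b = a [^] (q ^ (j - 1))"
  have b: "b \<in> carrier G" "x \<otimes> b = b \<otimes> x"
    unfolding b_def using a(1) group_commutes_pow[OF a(2)[symmetric] a(1) x(1)] by simp_all
  have "q ^ j = q * q ^ (j - 1)" using j by (cases j) auto
  then have ob: "ord b = q"
    unfolding b_def using ord_pow[OF a(1), of "q ^ (j - 1)"] a(3) prime_gt_0_nat[OF q(1)] by simp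
  then have "b \<noteq> \<one>" using q(1) prime_gt_1_nat by fastforce
  moreover have "b \<in> generate G {a}" unfolding b_def using mem_generate_iff[OF fin] a(1) by blast
  ultimately show ?thesis
    using comparable_if_common_multiplier[OF a(1) z(3) _ x(1) z(3) _ z(1,2)]
      order_q_mem_generate[OF b ob] a(1,3) x(1,2) q(2) by simp
qed

text \<open>Take \<open>y\<close> of maximal order among the \<open>q\<close>-elements commuting
  with \<open>x\<close>. An element \<open>a\<close> is a power of \<open>x\<close>, hence of
  \<open>y\<close>, or has \<open>x\<close> as a power. In the second case \<open>x\<close> is
  common to the subgroups of \<open>a\<close> and \<open>y\<close>, which is enough to compare them
  although \<open>a\<close> and \<open>y\<close> are not known to commute.\<close>

lemma primary_elements_generated:
  obtains y j where "y \<in> carrier G" "x \<otimes> y = y \<otimes> x" "ord y = q ^ j" "x \<in> generate G {y}"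
    "\<And>a i. a \<in> carrier G \<Longrightarrow> x \<otimes> a = a \<otimes> x \<Longrightarrow> ord a = q ^ i \<Longrightarrow> a \<in> generate G {y}"
proof -
  define S where "S = {a \<in> carrier G. x \<otimes> a = a \<otimes> x \<and> (\<exists>j. ord a = q ^ j)}"
  have S: "finite S" "x \<in> S" unfolding S_def using fin x by auto
  then obtain y where y: "y \<in> S" "\<And>a. a \<in> S \<Longrightarrow> ord a \<le> ord y"
    using obtains_MAX[OF S(1), of ord] by (metis Max_ge empty_iff finite_imageI image_eqI)
  obtain j where yj: "y \<in> carrier G" "x \<otimes> y = y \<otimes> x" "ord y = q ^ j"
    using y(1) by (auto simp: S_def)
  \<comment> \<open>Here \<open>ord y\<close> divides \<open>ord a\<close>, which is at most
    \<open>ord y\<close>, so both elements generate the same subgroup.\<close>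
  have maximal: "a \<in> generate G {y}" if "a \<in> S" "y \<in> generate G {a}" for a
  proof -
    have a: "a \<in> carrier G" using that by (simp add: S_def)
    have "ord y = ord a"
      using ord_dvd_if_mem_generate[OF fin a that(2)] y(2)[OF that(1)] ord_ge_1[OF fin a]
        dvd_imp_le[of "ord y" "ord a"] by simp
    then show ?thesis using mem_generate_if_same_ord[OF fin a that(2)] by simp
  qed
  have xy: "x \<in> generate G {y}" using primary_comparable[OF yj] maximal[OF S(2)] by blast
  have x1: "x \<noteq> \<one>" using x(3) prime_gt_1_nat[OF q(1)] by auto
  have "a \<in> generate G {y}" if a: "a \<in> carrier G" "x \<otimes> a = a \<otimes> x" "ord a = q ^ i" for a i
  proof -
    have "a \<in> S" using a by (auto simp: S_def)
    then have "a \<in> generate G {y}" if "x \<in> generate G {a}"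
      using comparable_if_common_multiplier[OF a(1) z(3) _ yj(1) z(3) _ z(1,2) that xy x1]
        maximal a(1,3) yj(1,3) q(2) by auto
    then show ?thesis
      using primary_comparable[OF a] generate_mono_elem[OF fin yj(1) xy] by blast
  qed
  then show thesis using that yj xy by blast
qed

end

section \<open>Structure of the centralizer\<close>

lemma centralizer_structure:
  assumes p: "prime p" and Z: "elementary_abelian p (center G)" "order (center G) > p"
    and q: "prime q" and qp: "q \<noteq> p"
    and xG: "x \<in> carrier G" and x1: "x \<noteq> \<one>" and k: "ord x = q ^ k"
  shows "prime_factors (order (centralizer G x)) = {p, q}" (is ?pi)
    and "\<And>P Q. \<lbrakk>ord x > q; sylow_subgroup p P (centralizer G x); sylow_subgroup q Q (centralizer G x)\<rbrakk> \<Longrightarrow>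
      exponent (G\<lparr>carrier := P\<rparr>) = p \<and> Q \<lhd> centralizer G x \<and>
      cyclic_group (G\<lparr>carrier := Q\<rparr>) \<and> internal_direct_product (centralizer G x) P Q"
proof -
  have k0: "k \<noteq> 0" using k ord_eq_1[OF xG] x1 by (intro notI) simp
  define C where "C = carrier (centralizer G x)"
  have CG: "centralizer G x = G\<lparr>carrier := C\<rparr>" by (simp add: C_def centralizer_def)
  have C: "subgroup C G" unfolding C_def using subgroup_centralizer[OF xG] .
  have C_iff: "g \<in> C \<longleftrightarrow> g \<in> carrier G \<and> g \<otimes> x = x \<otimes> g" for g
    by (simp add: C_def centralizer_def)
  have order_C: "order (centralizer G x) = card C" by (simp add: CG order_def)
  have C_pos: "0 < card C"
    using C fin finite_subset[OF subgroup.subset[OF C]] subgroup.one_closed[OF C] card_gt_0_iff by blast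
  obtain z1 z2 where z: "z1 \<in> carrier G" "z2 \<in> carrier G" "ord z1 = p" "ord z2 = p"
    "\<And>g. g \<in> carrier G \<Longrightarrow> z1 \<otimes> g = g \<otimes> z1" "\<And>g. g \<in> carrier G \<Longrightarrow> z2 \<otimes> g = g \<otimes> z2"
    "z1 \<notin> generate G {z2}" "z2 \<notin> generate G {z1}"
    using elementary_abelian_center_independent[OF fin p Z] by metis
  have coprime_pq: "coprime p q" using p q qp primes_coprime by blast
  have "r = p \<or> r = q" if r: "prime r" "r dvd card C" for r
  proof (rule ccontr)
    assume neq: "\<not> (r = p \<or> r = q)"
    obtain w where w: "w \<in> C" "ord w = r" using exists_ord_eq_prime[OF fin C r] by blast
    have "w \<noteq> \<one>" using w(2) r(1) by auto
    moreover have "coprime q r" "coprime r p" using neq p q r(1) primes_coprime by blast+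
    \<comment> \<open>The orders of \<open>x\<close>, \<open>w\<close> and the central elements
      involve three different primes, so \<open>z1\<close> and \<open>z2\<close> would be
      comparable, contrary to their choice.\<close>
    ultimately show False
      using coprime_triple_comparable[OF xG x1, of w p z1 z2] w C_iff k z coprime_pq
      by (simp add: coprime_commute)
  qed
  moreover have "p dvd card C"
    using ord_dvd_card_subgroup[OF C, of z1] C_iff z(1,3) z(5)[OF xG] by simp
  moreover have "q dvd card C"
    using ord_dvd_card_subgroup[OF C, of x] C_iff xG k k0 by (auto intro: dvd_trans[rotated])
  ultimately have pi: "prime_factors (card C) = {p, q}"
    using p q C_pos by (auto simp: prime_factors_dvd)
  then show ?pi by (simp add: order_C)
  show "exponent (G\<lparr>carrier := P\<rparr>) = p \<and> Q \<lhd> centralizer G x \<and>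
      cyclic_group (G\<lparr>carrier := Q\<rparr>) \<and> internal_direct_product (centralizer G x) P Q"
    if large: "ord x > q"
      and P: "sylow_subgroup p P (centralizer G x)" and Q: "sylow_subgroup q Q (centralizer G x)" for P Q
  proof -
    have subC: "subgroup P (G\<lparr>carrier := C\<rparr>)" "subgroup Q (G\<lparr>carrier := C\<rparr>)"
      using P Q by (auto simp: sylow_subgroup_def CG)
    then have sub: "subgroup P G" "subgroup Q G" using incl_subgroup[OF C] by auto
    have inC: "P \<subseteq> C" "Q \<subseteq> C" using subgroup.subset[OF subC(1)] subgroup.subset[OF subC(2)] by auto
    have card: "card P = p ^ multiplicity p (card C)" "card Q = q ^ multiplicity q (card C)"
      using P Q by (auto simp: sylow_subgroup_def order_C)
    have z1_ne: "z1 \<noteq> \<one>" using z(3) p by auto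
    have coprime_qz: "coprime q (ord z1)" using coprime_pq z(3) by (simp add: coprime_commute)
    obtain y j where y: "y \<in> carrier G" "x \<otimes> y = y \<otimes> x" "ord y = q ^ j" "x \<in> generate G {y}"
      and gen: "\<And>a i. a \<in> carrier G \<Longrightarrow> x \<otimes> a = a \<otimes> x \<Longrightarrow> ord a = q ^ i \<Longrightarrow> a \<in> generate G {y}"
      using primary_elements_generated[OF z(1) z1_ne z(5)[symmetric] q coprime_qz xG k large] by metis
    have yC: "y \<in> C" using C_iff y by simp
    have gen_sub: "subgroup (generate G {y}) G" using y(1) generate_is_subgroup by simp
    have gen_fin: "finite (generate G {y})"
      using finite_subset[OF subgroup.subset[OF gen_sub] fin] .
    have "Q \<subseteq> generate G {y}"
    proof
      fix a assume a: "a \<in> Q"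
      have "ord a dvd q ^ multiplicity q (card C)"
        using ord_dvd_card_subgroup[OF sub(2) a] card(2) by simp
      then obtain i where "ord a = q ^ i" using divides_primepow_nat[OF q] by blast
      moreover have "a \<in> C" using a inC by blast
      ultimately show "a \<in> generate G {y}" using gen[of a i] C_iff by simp
    qed
    \<comment> \<open>The reverse inclusion follows by size: \<open>ord y\<close> is a power of
      \<open>q\<close> dividing \<open>card C\<close>, hence at most the Sylow order
      \<open>card Q\<close>.\<close>
    moreover have "card (generate G {y}) \<le> card Q"
    proof -
      have "q ^ j dvd card C" using ord_dvd_card_subgroup[OF C yC] y(3) by simp
      then have "j \<le> multiplicity q (card C)"
        using C_pos prime_gt_1_nat[OF q] by (intro multiplicity_geI) auto
      then have "q ^ j \<le> card Q"
        using card(2) prime_gt_0_nat[OF q] by (simp add: power_increasing)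
      then show ?thesis using generate_pow_card[OF y(1)] y(3) by simp
    qed
    ultimately have Q_eq: "Q = generate G {y}" using gen_fin by (simp add: card_seteq)
    have pow_p: "u [^] p = \<one>" if u: "u \<in> P" for u
    proof (cases "u = \<one>")
      case False
      have uC: "u \<in> carrier G" "x \<otimes> u = u \<otimes> x" using u inC C_iff by auto
      have "ord u dvd p ^ multiplicity p (card C)"
        using ord_dvd_card_subgroup[OF sub(1) u] card(1) by simp
      then obtain i where i: "ord u = p ^ i" using divides_primepow_nat[OF p] by blast
      moreover have "i \<noteq> 0" using i False ord_eq_1[OF uC(1)] by (intro notI) simp
      ultimately show ?thesis
        using pow_prime_eq_one_if_commutes[OF p q _ xG _ large uC(1) _ uC(2)] k k0 coprime_pq
        by (simp add: coprime_commute)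
    qed simp
    have comm_y: "u \<otimes> y = y \<otimes> u" if u: "u \<in> P" for u
    proof (rule coprime_conj_commutes[OF fin q, of p u y j x])
      have uC: "u \<in> C" "u \<in> carrier G" using u inC C_iff by auto
      show "\<not> q dvd p" using p q qp primes_dvd_imp_eq by blast
      show "u \<otimes> x = x \<otimes> u" using uC C_iff by simp
      \<comment> \<open>The conjugate stays in \<open>C\<close> and keeps the order
        \<open>q ^ j\<close>, and \<open>y\<close> generates all such elements; so \<open>u\<close>
        normalizes the subgroup of \<open>y\<close>.\<close>
      have "u \<otimes> y \<otimes> inv u \<in> C"
        using uC yC subgroup.m_closed[OF C] subgroup.m_inv_closed[OF C] by simp
      then show "u \<otimes> y \<otimes> inv u \<in> generate G {y}"
        using gen[of "u \<otimes> y \<otimes> inv u" j] C_iff ord_conj[OF uC(2) y(1)] y(3) by simp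
      show "u \<in> carrier G" using uC by simp
    qed (use u pow_p y x1 in auto)
    have comm: "u \<otimes> v = v \<otimes> u" if uv: "u \<in> P" "v \<in> Q" for u v
    proof -
      obtain i :: nat where "v = y [^] i"
        using uv(2) Q_eq mem_generate_iff[OF fin y(1)] by blast
      then show ?thesis
        using group_commutes_pow[OF comm_y[OF uv(1), symmetric] y(1)] uv(1) inC C_iff by auto
    qed
    \<comment> \<open>Since \<open>p\<close> and \<open>q\<close> are the only primes dividing
      \<open>card C\<close>, it is the product of its \<open>p\<close>-part and its
      \<open>q\<close>-part.\<close>
    have "card P * card Q = card C"
      using prime_factorization_nat[OF C_pos] qp by (simp add: pi card)
    moreover have "finite C" using finite_subset[OF subgroup.subset[OF C] fin] .
    ultimately have direct: "internal_direct_product (centralizer G x) P Q"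
      unfolding CG
      by (intro group.internal_direct_product_if_coprime_commuting[OF subgroup_imp_group[OF C] _ subC])
         (auto simp: order_def card coprime_pq intro: comm)
    \<comment> \<open>A nontrivial \<open>P\<close> is what makes its exponent \<open>p\<close>
      rather than 1.\<close>
    have "multiplicity p (card C) \<noteq> 0"
      using pi p C_pos by (auto simp: prime_factors_multiplicity)
    then have "card P \<noteq> 1" using card(1) prime_gt_1_nat[OF p] by simp
    then have "P \<noteq> {\<one>}" by auto
    then have "exponent (G\<lparr>carrier := P\<rparr>) = p"
      using exponent_subgroup_eq_prime[OF sub(1) _ p pow_p] by blast
    then show ?thesis
      using direct cyclic_group_generate[OF y(1)] Q_eq by (simp add: internal_direct_product_def)
  qed
qed

end

theorem theorem3p8:
  fixes G :: "('a, 'b) monoid_scheme" and p q :: nat and x :: 'a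
  assumes "group G" and "finite (carrier G)"
    and "C4_free (with_proj (power_graph G))"
    and "\<not> primepow (order G)"
    and "prime p"
    and "elementary_abelian p (center G)" and "order (center G) > p"
    and "prime q" and "q \<noteq> p"
    and "x \<in> carrier G" and "x \<noteq> \<one>\<^bsub>G\<^esub>" and "\<exists>k. group.ord G x = q ^ k"
  shows "prime_factors (order (centralizer G x)) = {p, q} \<and>
    (group.ord G x > q \<longrightarrow>
      (\<forall>P Q. sylow_subgroup p P (centralizer G x) \<longrightarrow> sylow_subgroup q Q (centralizer G x) \<longrightarrow>
        (exponent (G\<lparr>carrier := P\<rparr>) = p \<and>
         Q \<lhd> centralizer G x \<and> cyclic_group (G\<lparr>carrier := Q\<rparr>)) \<and>
        (internal_direct_product (centralizer G x) P Q \<or>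
         (\<forall>y R. generate G {y} = Q \<longrightarrow>
            sylow_subgroup p R (centralizer (centralizer G x) y) \<longrightarrow>
            internal_direct_product (G\<lparr>carrier := R <#>\<^bsub>G\<^esub> Q\<rparr>) R Q \<and>
            (\<exists>K. G\<lparr>carrier := K\<rparr> \<cong> integer_mod_group p \<and>
                 internal_semidirect_product (centralizer G x) (R <#>\<^bsub>G\<^esub> Q) K)))))"
proof -
  interpret C4_free_group G
    using assms(1-3) by (simp add: C4_free_group_def C4_free_group_axioms_def)
  obtain k where "ord x = q ^ k" using assms(12) by blast
  note centralizer_structure[OF assms(5-11) this]
  then show ?thesis by blast
qed

end
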